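(* Let $d,m,N\ge 1$ be integers and let $A\in M_N(\mathbb{R})$, $B\in M_{N,m}(\mathbb{R})$, $C\in M_{d,N}(\mathbb{R})$ be the coefficient matrices of a Lévy-driven linear state space model, with transfer function $H(z)=C(z\mathbb{I}_N-A)^{-1}B$. Then there exist $p,q,\tilde q\in\mathbb{N}_0$ with $p>q$ and $p>\tilde q$, and matrix polynomials $P\in M_d(\mathbb{R}[z])$, $Q\in M_{d,m}(\mathbb{R}[z])$ (left matrix fraction description) and $\widetilde P\in M_m(\mathbb{R}[z])$, $\widetilde Q\in M_{d,m}(\mathbb{R}[z])$ (right matrix fraction description) of the form $$P(z)=\mathbb{I}_dz^p+A_1z^{p-1}+\cdots+A_p,\qquad Q(z)=B_0z^q+B_1z^{q-1}+\cdots+B_q,$$ $$\widetilde P(z)=\mathbb{I}_mz^p+\widetilde A_1z^{p-1}+\cdots+\widetilde A_p,\qquad \widetilde Q(z)=\widetilde B_0z^{\tilde q}+\widetilde B_1z^{\tilde q-1}+\cdots+\widetilde B_{\tilde q},$$ with $A_i\in M_d(\mathbb{R})$, $\widetilde A_i\in M_m(\mathbb{R})$ and $B_i,\widetilde B_i\in M_{d,m}(\mathbb{R})$, such that $$H(z)=C(z\mathbb{I}_N-A)^{-1}B=P^{-1}(z)Q(z)=\widetilde Q(z)\widetilde P^{-1}(z)$$ as an identity of matrices of rational functions in $z$ (that is, for all $z\in\mathbb{C}$ at which the inverses exist).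
   Context: $M_{k,l}(R)$ denotes the $k\times l$ matrices over a ring $R$, $M_k(R)=M_{k,k}(R)$; $\mathbb{R}[z]$ is the ring of real polynomials in $z$; $\mathbb{I}_k$ is the $k\times k$ identity matrix; $\mathbb{N}_0=\{0,1,2,\ldots\}$. A Lévy-driven linear state space model with coefficient matrices $A,B,C$ is a system $\mathrm{d}\boldsymbol{X}(t)=A\boldsymbol{X}(t)\,\mathrm{d}t+B\,\mathrm{d}\boldsymbol{L}(t)$, $\boldsymbol{Y}(t)=C\boldsymbol{X}(t)$, $t\in\mathbb{R}$, where $\boldsymbol{L}$ is an $\mathbb{R}^m$-valued Lévy process; its transfer function $H(z)=C(z\mathbb{I}_N-A)^{-1}B$ depends only on $A,B,C$. *)

theory Defs
  imports "HOL-Analysis.Analysis" "HOL-Computational_Algebra.Computational_Algebra"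
begin

text \<open>
  A \<open>k \<times> l\<close> matrix over \<open>R\<close> is an element of \<open>R ^ 'l ^ 'k\<close>; the real rational functions in \<open>z\<close> are
  the fraction field \<open>real poly fract\<close>.  A matrix polynomial can be read in two ways: as a matrix
  over that field, or as a matrix-valued function on the complex numbers.
\<close>

definition ratfun_mat :: "real poly ^ 'l ^ 'k \<Rightarrow> real poly fract ^ 'l ^ 'k" where
  "ratfun_mat M = map_matrix to_fract M"

definition eval_mat :: "real poly ^ 'l ^ 'k \<Rightarrow> complex \<Rightarrow> complex ^ 'l ^ 'k" where
  "eval_mat M z = map_matrix (\<lambda>f. poly (map_poly complex_of_real f) z) M"

definition const_ratfun :: "real \<Rightarrow> real poly fract" where
  "const_ratfun a = to_fract [:a:]"

definition indet :: "real poly fract" where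
  "indet = to_fract [:0, 1:]"

text \<open>
  The library's \<open>matrix_inv\<close> is unspecified on singular matrices.  This does not matter for
  \<open>transfer_function\<close>, since \<open>z I - A\<close> is always invertible over the rational functions; the values
  of \<open>transfer_function_at\<close> are meaningful where \<open>z\<close> is not an eigenvalue of \<open>A\<close>.
\<close>

definition transfer_function ::
    "real ^ 'N ^ 'N \<Rightarrow> real ^ 'm ^ 'N \<Rightarrow> real ^ 'N ^ 'd \<Rightarrow> real poly fract ^ 'm ^ 'd" where
  "transfer_function A B C =
     map_matrix const_ratfun C ** matrix_inv (mat indet - map_matrix const_ratfun A)
       ** map_matrix const_ratfun B"

definition transfer_function_at ::
    "real ^ 'N ^ 'N \<Rightarrow> real ^ 'm ^ 'N \<Rightarrow> real ^ 'N ^ 'd \<Rightarrow> complex \<Rightarrow> complex ^ 'm ^ 'd" where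
  "transfer_function_at A B C z =
     map_matrix complex_of_real C ** matrix_inv (mat z - map_matrix complex_of_real A)
       ** map_matrix complex_of_real B"

text \<open>\<open>mat_poly n K\<close> is \<open>K\<^sub>0 z\<^sup>n + K\<^sub>1 z\<^sup>n\<^sup>-\<^sup>1 + \<dots> + K\<^sub>n\<close>: \<open>K i\<close> is the coefficient of \<open>z\<^sup>n\<^sup>-\<^sup>i\<close>.\<close>

definition mat_poly :: "nat \<Rightarrow> (nat \<Rightarrow> real ^ 'l ^ 'k) \<Rightarrow> real poly ^ 'l ^ 'k" where
  "mat_poly n K = (\<Sum>i = 0..n. map_matrix (\<lambda>a. monom a (n - i)) (K i))"

end

(* A is a root of some monic polynomial a of degree p > 0, because the powers of A are linearly
   dependent. Dividing a(z) I by z I - A leaves the remainder a(A) = 0, so (z I - A) R(z) = a(z) I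
   for a matrix polynomial R of degree p - 1, and H(z) = C R(z) B / a(z). Hence the scalar matrix
   a(z) I is a common denominator, with the same numerator C R(z) B on either side. The computation
   is done once for an arbitrary homomorphism from the reals to a field, which covers the rational
   functions as well as evaluation at complex points. *)

theory Submission
  imports Defs
begin

section \<open>A monic polynomial annihilating a square matrix\<close>

text \<open>Otherwise the first \<open>n\<close> terms are distinct and independent for every
  \<open>n\<close>, which exceeds the dimension at \<open>n = Suc DIM('a)\<close>.\<close>

lemma ex_in_span_of_predecessors:
  fixes f :: "nat \<Rightarrow> 'a::euclidean_space"
  shows "\<exists>n. f n \<in> span (f ` {..<n})"
proof (rule ccontr)
  assume "\<not> ?thesis"
  then have notin: "f n \<notin> span (f ` {..<n})" for n
    by blast
  have "independent (f ` {..<n}) \<and> card (f ` {..<n}) = n" for n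
  proof (induction n)
    case (Suc n)
    with notin[of n] show ?case
      by (auto simp: lessThan_Suc independent_insert card_insert_if intro: span_base)
  qed (simp add: independent_empty)
  from this[of "Suc DIM('a)"] show False
    using independent_bound[of "f ` {..<Suc DIM('a)}"] by simp
qed

text \<open>The coefficients are indexed by position, not by vector, so \<open>f\<close> may repeat
  values; the induction splits off the multiple of the last term.\<close>

lemma in_span_image_lessThanE:
  fixes f :: "nat \<Rightarrow> 'a::real_vector"
  assumes "x \<in> span (f ` {..<n})"
  obtains c where "x = (\<Sum>i<n. c i *\<^sub>R f i)"
  using assms
proof (induction n arbitrary: x thesis)
  case (Suc n)
  obtain k where "x - k *\<^sub>R f n \<in> span (f ` {..<n})"
    using Suc.prems(2) by (auto simp: lessThan_Suc span_breakdown_eq)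
  then obtain c where "x - k *\<^sub>R f n = (\<Sum>i<n. c i *\<^sub>R f i)"
    using Suc.IH by blast
  then have "x = (\<Sum>i<Suc n. (c(n := k)) i *\<^sub>R f i)"
    by (simp add: algebra_simps)
  then show ?case
    by (rule Suc.prems(1))
qed simp

lemma matrix_mult_sum_right: "A ** sum f S = (\<Sum>i\<in>S. A ** f i)"
  for A :: "'a::semiring_1 ^ 'n ^ 'm"
  by (induction S rule: infinite_finite_induct)
    (simp_all add: matrix_add_ldistrib matrix_matrix_mult_def[of A 0] vec_eq_iff)

text \<open>The coefficients of \<open>a\<close> are numbered from the leading one downwards, as in \<open>mat_poly\<close>.\<close>

primrec horner_mat :: "real ^ 'n ^ 'n \<Rightarrow> (nat \<Rightarrow> real) \<Rightarrow> nat \<Rightarrow> real ^ 'n ^ 'n" where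
  "horner_mat A a 0 = mat (a 0)"
| "horner_mat A a (Suc i) = A ** horner_mat A a i + mat (a (Suc i))"

text \<open>Unrolling Horner's scheme shows that \<open>horner_mat A a n\<close> is the value at
  \<open>A\<close> of the polynomial with coefficients \<open>a 0, ..., a n\<close>; powers of
  \<open>A\<close> appear as iterated left multiplication.\<close>

lemma horner_mat_conv_sum:
  "horner_mat A a n = (\<Sum>j\<le>n. a j *\<^sub>R (((**) A ^^ (n - j)) (mat 1)))"
proof (induction n)
  case 0
  show ?case by (simp add: vec_eq_iff mat_def)
next
  case (Suc n)
  have "(\<Sum>j\<le>n. a j *\<^sub>R (A ** ((**) A ^^ (n - j)) (mat 1)))
      = (\<Sum>j\<le>n. a j *\<^sub>R (((**) A ^^ (Suc n - j)) (mat 1)))"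
    by (rule sum.cong) (simp_all add: Suc_diff_le)
  moreover have "a (Suc n) *\<^sub>R mat 1 = (mat (a (Suc n)) :: real ^ 'a ^ 'a)"
    by (simp add: vec_eq_iff mat_def)
  ultimately show ?case
    by (simp add: Suc matrix_mult_sum_right matrix_scalar_ac
        flip: scalar_matrix_assoc)
qed

lemma ex_monic_annihilating_horner:
  fixes A :: "real ^ 'n ^ 'n"
  obtains n a where "a 0 = 1" "horner_mat A a (Suc n) = 0"
proof -
  define f where "f i = ((**) A ^^ i) (mat 1)" for i
  obtain p where p: "f p \<in> span (f ` {..<p})"
    using ex_in_span_of_predecessors by blast
  then obtain c where c: "f p = (\<Sum>i<p. c i *\<^sub>R f i)"
    by (rule in_span_image_lessThanE)
  \<comment> \<open>The empty span is zero but \<open>f 0\<close> is the identity, so the degree is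
    positive.\<close>
  have "f 0 \<noteq> 0"
    by (auto simp: f_def vec_eq_iff mat_def)
  with p have "p \<noteq> 0"
    by (auto intro: ccontr)
  then obtain n where n: "p = Suc n"
    using not0_implies_Suc by blast
  \<comment> \<open>The dependence relation is moved to one side, which gives the sign;
    \<open>p - i\<close> reverses the order, since \<open>a\<close> starts at the leading
    coefficient.\<close>
  define a where "a i = (if i = 0 then 1 else - c (p - i))" for i
  have "horner_mat A a p = (\<Sum>j\<le>p. a (p - j) *\<^sub>R f j)"
    unfolding horner_mat_conv_sum f_def
    by (rule sum.reindex_bij_witness[of _ "\<lambda>j. p - j" "\<lambda>j. p - j"]) auto
  also have "\<dots> = f p + (\<Sum>j<p. a (p - j) *\<^sub>R f j)"
    by (simp add: a_def add.commute flip: lessThan_Suc_atMost)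
  also have "(\<Sum>j<p. a (p - j) *\<^sub>R f j) = - f p"
    unfolding c sum_negf[symmetric] by (rule sum.cong) (auto simp: a_def)
  finally show thesis
    using that[of a n] by (simp del: horner_mat.simps(2) add: n) (simp add: a_def)
qed

section \<open>Scalar matrices and matrix inverses\<close>

lemma mat_mult_component: "(mat c ** X) $ i $ j = c * X $ i $ j"
  for X :: "'a::semiring_1 ^ 'n ^ 'm"
  by (simp add: matrix_matrix_mult_def mat_def if_distrib if_distribR cong: if_cong)

lemma mult_mat_component: "(X ** mat c) $ i $ j = X $ i $ j * c"
  for X :: "'a::semiring_1 ^ 'n ^ 'm"
  by (simp add: matrix_matrix_mult_def mat_def if_distrib if_distribR cong: if_cong)

lemma mat_mult_commute: "mat c ** X = X ** mat c"
  for X :: "'a::comm_semiring_1 ^ 'n ^ 'm"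
  by (simp add: vec_eq_iff mat_mult_component mult_mat_component mult.commute)

lemma mat_mult_mat: "mat c ** mat d = mat (c * d)"
  by (simp add: vec_eq_iff mat_mult_component) (simp add: mat_def)

lemma matrix_add_rdistrib: "(A + B) ** C = A ** C + B ** C"
  for A :: "'a::semiring_1 ^ 'n ^ 'm"
  by (simp add: vec_eq_iff matrix_matrix_mult_def distrib_right sum.distrib)

lemma matrix_diff_ldistrib: "A ** (B - C) = A ** B - A ** C"
  for A :: "'a::ring_1 ^ 'n ^ 'm"
  by (simp add: vec_eq_iff matrix_matrix_mult_def right_diff_distrib sum_subtractf)

lemma matrix_diff_rdistrib: "(A - B) ** C = A ** C - B ** C"
  for A :: "'a::ring_1 ^ 'n ^ 'm"
  by (simp add: vec_eq_iff matrix_matrix_mult_def left_diff_distrib sum_subtractf)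

text \<open>For square matrices over a field a right inverse is two-sided, so the choice in
  \<open>matrix_inv\<close> yields a genuine inverse, and inverses are unique.\<close>

lemma matrix_inv_eqI:
  fixes M :: "'a::field ^ 'n ^ 'n"
  assumes "M ** R = mat 1"
  shows "matrix_inv M = R"
proof -
  have "R ** M = mat 1"
    using assms by (simp add: matrix_left_right_inverse)
  with assms have "M ** matrix_inv M = mat 1 \<and> matrix_inv M ** M = mat 1"
    unfolding matrix_inv_def
    by (intro someI[of "\<lambda>X. M ** X = mat 1 \<and> X ** M = mat 1" R]) simp
  then have "R = matrix_inv M ** (M ** R)"
    by (simp add: matrix_mul_assoc)
  then show ?thesis
    by (simp add: assms)
qed

lemma invertible_mat_iff: "invertible (mat c :: 'a::field ^ 'n ^ 'n) \<longleftrightarrow> c \<noteq> 0"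
proof
  assume "invertible (mat c :: 'a ^ 'n ^ 'n)"
  then obtain X :: "'a ^ 'n ^ 'n" where "mat c ** X = mat 1"
    unfolding invertible_def by blast
  then have "(mat c ** X) $ i $ i = 1" for i
    by (simp add: mat_def)
  then show "c \<noteq> 0"
    by (auto simp: mat_mult_component)
next
  assume "c \<noteq> 0"
  then show "invertible (mat c :: 'a ^ 'n ^ 'n)"
    unfolding invertible_def by (intro exI[of _ "mat (inverse c)"]) (simp add: mat_mult_mat)
qed

lemma matrix_inv_mat:
  fixes c :: "'a::field"
  shows "c \<noteq> 0 \<Longrightarrow> matrix_inv (mat c) = mat (inverse c)"
  by (rule matrix_inv_eqI) (simp add: mat_mult_mat)

section \<open>Matrix polynomials evaluated in a field\<close>

locale real_field_hom =
  fixes h :: "real \<Rightarrow> 'a::field"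
  assumes h_0: "h 0 = 0" and h_1: "h 1 = 1"
    and h_add: "h (x + y) = h x + h y" and h_mult: "h (x * y) = h x * h y"
begin

text \<open>This is \<open>mat_poly n K\<close> with coefficients carried along \<open>h\<close> and
  evaluated at \<open>z\<close>; the choice \<open>z = indet\<close> recovers the polynomial matrix
  over the rational functions.\<close>

definition ev :: "'a \<Rightarrow> nat \<Rightarrow> (nat \<Rightarrow> real ^ 'l ^ 'k) \<Rightarrow> 'a ^ 'l ^ 'k" where
  "ev z n K = (\<Sum>i = 0..n. map_matrix (\<lambda>x. z ^ (n - i) * h x) (K i))"

lemma h_sum: "h (sum f S) = (\<Sum>i\<in>S. h (f i))"
  by (induction S rule: infinite_finite_induct) (simp_all add: h_0 h_add)

lemma map_matrix_mult: "map_matrix h (X ** Y) = map_matrix h X ** map_matrix h Y"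
  by (simp add: vec_eq_iff matrix_matrix_mult_def h_sum h_mult)

lemma map_matrix_add: "map_matrix h (X + Y) = map_matrix h X + map_matrix h Y"
  by (simp add: vec_eq_iff h_add)

lemma map_matrix_mat: "map_matrix h (mat c) = mat (h c)"
  by (simp add: vec_eq_iff mat_def h_0)

lemma ev_0: "ev z 0 K = map_matrix h (K 0)"
  by (simp add: ev_def)

text \<open>Numbering from the top makes a further coefficient multiply the earlier part by
  \<open>z\<close>, the same recursion as in \<open>horner_mat\<close>.\<close>

lemma ev_Suc: "ev z (Suc n) K = mat z ** ev z n K + map_matrix h (K (Suc n))"
  by (simp add: ev_def vec_eq_iff mat_mult_component sum_distrib_left Suc_diff_le mult.assoc)

lemma ev_mat: "ev z n (\<lambda>i. mat (a i)) = mat (\<Sum>i\<le>n. z ^ (n - i) * h (a i))"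
proof (induction n)
  case (Suc n)
  have "z * (\<Sum>i\<le>n. z ^ (n - i) * h (a i)) = (\<Sum>i\<le>n. z ^ (Suc n - i) * h (a i))"
    by (simp add: sum_distrib_left Suc_diff_le mult.assoc)
  then show ?case
    by (simp add: ev_Suc Suc map_matrix_mat mat_mult_mat) (simp add: vec_eq_iff mat_def)
qed (simp add: ev_0 map_matrix_mat)

text \<open>The scalar matrix \<open>mat z\<close> commutes past \<open>C\<close>, so constant
  factors can be absorbed into the coefficients. This gives the numerator its coefficients.\<close>

lemma ev_mult:
  "ev z n (\<lambda>i. C ** K i ** B) = map_matrix h C ** ev z n K ** map_matrix h B"
proof (induction n)
  case (Suc n)
  have "mat z ** (map_matrix h C ** ev z n K ** map_matrix h B)
      = map_matrix h C ** (mat z ** ev z n K) ** map_matrix h B"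
    by (simp add: matrix_mul_assoc mat_mult_commute[of z "map_matrix h C"])
  then show ?case
    by (simp add: ev_Suc Suc map_matrix_mult matrix_add_ldistrib matrix_add_rdistrib)
qed (simp add: ev_0 map_matrix_mult)

text \<open>Synthetic division of \<open>a(z) I\<close> by \<open>z I - A\<close>: the Horner matrices are the coefficients of
  the quotient, and the last of them is the remainder \<open>a(A)\<close>.\<close>

lemma resolvent_times_horner:
  "(mat z - map_matrix h A) ** ev z n (horner_mat A a)
     = ev z (Suc n) (\<lambda>i. mat (a i)) - map_matrix h (horner_mat A a (Suc n))"
proof (induction n)
  case 0
  show ?case
    by (simp add: ev_Suc ev_0 map_matrix_add map_matrix_mult matrix_diff_rdistrib)
next
  case (Suc n)
  have "(mat z - map_matrix h A) ** (mat z ** ev z n (horner_mat A a))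
      = mat z ** ((mat z - map_matrix h A) ** ev z n (horner_mat A a))"
    by (simp add: matrix_mul_assoc mat_mult_commute[of z "mat z - map_matrix h A"])
  \<comment> \<open>The old remainder times \<open>z\<close> cancels the \<open>z\<close> part of
    the new quotient term; the \<open>A\<close> part left over goes into the new remainder.\<close>
  then show ?case
    unfolding ev_Suc[of z n "horner_mat A a"] ev_Suc[of z "Suc n" "\<lambda>i. mat (a i)"] Suc
      matrix_add_ldistrib
    by (simp only: Suc horner_mat.simps(2)[of A a "Suc n"] map_matrix_add map_matrix_mult
        matrix_diff_rdistrib matrix_diff_ldistrib) (simp add: algebra_simps)
qed

text \<open>With zero remainder, the quotient divided by the nonzero scalar \<open>a(z)\<close> is
  the inverse of \<open>z I - A\<close>. Scalar matrices commute with every matrix, so one numerator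
  serves both sides; the denominators differ only in size.\<close>

lemma transfer_function_eq:
  fixes A :: "real ^ 'n ^ 'n" and B :: "real ^ 'm ^ 'n" and C :: "real ^ 'n ^ 'd"
    and a :: "nat \<Rightarrow> real"
  defines "H \<equiv> \<lambda>z. map_matrix h C ** matrix_inv (mat z - map_matrix h A) ** map_matrix h B"
  assumes root: "horner_mat A a (Suc n) = 0"
    and nz: "(\<Sum>i\<le>Suc n. z ^ (Suc n - i) * h (a i)) \<noteq> 0"
  shows "H z = matrix_inv (ev z (Suc n) (\<lambda>i. mat (a i))) ** ev z n (\<lambda>i. C ** horner_mat A a i ** B)"
    and "H z = ev z n (\<lambda>i. C ** horner_mat A a i ** B) ** matrix_inv (ev z (Suc n) (\<lambda>i. mat (a i)))"
proof -
  let ?c = "\<Sum>i\<le>Suc n. z ^ (Suc n - i) * h (a i)"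
  let ?R = "ev z n (horner_mat A a)"
  have "(mat z - map_matrix h A) ** ?R = mat ?c"
    using map_matrix_mat[of 0] by (simp only: resolvent_times_horner root ev_mat) (simp add: h_0)
  then have "(mat z - map_matrix h A) ** (?R ** mat (inverse ?c)) = mat 1"
    using nz by (simp only: matrix_mul_assoc mat_mult_mat) simp
  then have inv: "matrix_inv (mat z - map_matrix h A) = ?R ** mat (inverse ?c)"
    by (rule matrix_inv_eqI)
  have "H z = map_matrix h C ** (?R ** mat (inverse ?c)) ** map_matrix h B"
    unfolding H_def inv ..
  also have "\<dots> = mat (inverse ?c) ** (map_matrix h C ** ?R ** map_matrix h B)"
    by (simp only: matrix_mul_assoc mat_mult_commute[of _ ?R, symmetric]
        mat_mult_commute[of _ "map_matrix h C", symmetric])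
  finally have H: "H z = mat (inverse ?c) ** ev z n (\<lambda>i. C ** horner_mat A a i ** B)"
    by (simp only: ev_mult)
  from H show "H z = matrix_inv (ev z (Suc n) (\<lambda>i. mat (a i)))
      ** ev z n (\<lambda>i. C ** horner_mat A a i ** B)"
    using nz by (simp only: ev_mat matrix_inv_mat not_False_eq_True)
  from H show "H z = ev z n (\<lambda>i. C ** horner_mat A a i ** B)
      ** matrix_inv (ev z (Suc n) (\<lambda>i. mat (a i)))"
    using nz by (simp only: ev_mat matrix_inv_mat not_False_eq_True mat_mult_commute)
qed

end

section \<open>Rational functions and complex evaluation as instances\<close>

interpretation ratfun: real_field_hom const_ratfun
  by unfold_locales
    (simp_all add: const_ratfun_def flip: one_pCons to_fract_add to_fract_mult)

interpretation cplx: real_field_hom complex_of_real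
  by unfold_locales simp_all

lemma const_ratfun_times_indet: "indet ^ k * const_ratfun x = to_fract (monom x k)"
proof -
  have "to_fract ([:0, 1:] ^ k) = indet ^ k"
    unfolding indet_def by (induction k) (simp_all only: power_0 power_Suc to_fract_1 to_fract_mult)
  moreover have "monom x k = [:0, 1:] ^ k * [:x:]"
    by (simp add: monom_altdef)
  then have "to_fract (monom x k) = to_fract ([:0, 1:] ^ k) * to_fract [:x:]"
    by (simp only: to_fract_mult)
  ultimately show ?thesis
    by (simp only: const_ratfun_def)
qed

lemma ratfun_mat_mat_poly: "ratfun_mat (mat_poly n K) = ratfun.ev indet n K"
  by (simp add: ratfun_mat_def mat_poly_def ratfun.ev_def vec_eq_iff const_ratfun_times_indet)

lemma poly_map_poly_add:
  "poly (map_poly complex_of_real (f + g)) z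
     = poly (map_poly complex_of_real f) z + poly (map_poly complex_of_real g) z"
proof -
  have "map_poly complex_of_real (f + g) = map_poly complex_of_real f + map_poly complex_of_real g"
    by (rule poly_eqI) (simp add: coeff_map_poly)
  then show ?thesis by simp
qed

lemma eval_mat_mat_poly: "eval_mat (mat_poly n K) z = cplx.ev z n K"
proof -
  have "poly (map_poly complex_of_real (sum f S)) z
      = (\<Sum>i\<in>S. poly (map_poly complex_of_real (f i)) z)" for f and S :: "nat set"
    by (induction S rule: infinite_finite_induct) (simp_all add: poly_map_poly_add)
  then show ?thesis
    by (simp add: eval_mat_def mat_poly_def cplx.ev_def vec_eq_iff map_poly_monom poly_monom
        mult.commute)
qed

text \<open>Only the term \<open>i = 0\<close> contributes to the coefficient of degree
  \<open>n\<close>, which is therefore 1, and \<open>to_fract\<close> sends only 0 to 0.\<close>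

lemma monic_ratfun_neq_0:
  assumes "a 0 = 1"
  shows "(\<Sum>i\<le>n. indet ^ (n - i) * const_ratfun (a i)) \<noteq> 0"
proof -
  have "(\<Sum>i\<le>n. indet ^ (n - i) * const_ratfun (a i)) = to_fract (\<Sum>i\<le>n. monom (a i) (n - i))"
    by (simp only: const_ratfun_times_indet to_fract_sum)
  moreover have "coeff (\<Sum>i\<le>n. monom (a i) (n - i)) n = (\<Sum>i\<le>n. if i = 0 then a i else 0)"
    unfolding coeff_sum by (rule sum.cong) auto
  then have "(\<Sum>i\<le>n. monom (a i) (n - i)) \<noteq> 0"
    using assms by auto
  ultimately show ?thesis
    by (simp only: to_fract_eq_0_iff not_False_eq_True)
qed

theorem proposition2p3:
  fixes A :: "real ^ 'N ^ 'N" and B :: "real ^ 'm ^ 'N" and C :: "real ^ 'N ^ 'd"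
  shows "\<exists>(p::nat) (q::nat) (q'::nat)
            (P :: real poly ^ 'd ^ 'd) (Q :: real poly ^ 'm ^ 'd)
            (P' :: real poly ^ 'm ^ 'm) (Q' :: real poly ^ 'm ^ 'd)
            (As :: nat \<Rightarrow> real ^ 'd ^ 'd) (Bs :: nat \<Rightarrow> real ^ 'm ^ 'd)
            (As' :: nat \<Rightarrow> real ^ 'm ^ 'm) (Bs' :: nat \<Rightarrow> real ^ 'm ^ 'd).
          p > q \<and> p > q' \<and>
          As 0 = mat 1 \<and> P = mat_poly p As \<and> Q = mat_poly q Bs \<and>
          As' 0 = mat 1 \<and> P' = mat_poly p As' \<and> Q' = mat_poly q' Bs' \<and>
          invertible (ratfun_mat P) \<and> invertible (ratfun_mat P') \<and>
          transfer_function A B C = matrix_inv (ratfun_mat P) ** ratfun_mat Q \<and>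
          transfer_function A B C = ratfun_mat Q' ** matrix_inv (ratfun_mat P') \<and>
          (\<forall>z::complex. invertible (mat z - map_matrix complex_of_real A) \<longrightarrow>
             (invertible (eval_mat P z) \<longrightarrow>
                transfer_function_at A B C z = matrix_inv (eval_mat P z) ** eval_mat Q z) \<and>
             (invertible (eval_mat P' z) \<longrightarrow>
                transfer_function_at A B C z = eval_mat Q' z ** matrix_inv (eval_mat P' z)))"
proof -
  obtain n a where a0: "a 0 = 1" and root: "horner_mat A a (Suc n) = 0"
    by (rule ex_monic_annihilating_horner)
  define Bs where "Bs i = C ** horner_mat A a i ** B" for i
  \<comment> \<open>Both denominators are \<open>a(z) I\<close>, in sizes \<open>d\<close> and
    \<open>m\<close>. Their degree \<open>Suc n\<close> exceeds the formal degree \<open>n\<close>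
    of the common numerator \<open>Q\<close>.\<close>
  define P :: "real poly ^ 'd ^ 'd" where "P = mat_poly (Suc n) (\<lambda>i. mat (a i))"
  define P' :: "real poly ^ 'm ^ 'm" where "P' = mat_poly (Suc n) (\<lambda>i. mat (a i))"
  define Q where "Q = mat_poly n Bs"
  note nz = monic_ratfun_neq_0[of a, OF a0, of "Suc n"]
  have inv: "invertible (ratfun_mat P)" "invertible (ratfun_mat P')"
    using nz by (simp_all only: P_def P'_def ratfun_mat_mat_poly ratfun.ev_mat invertible_mat_iff)
      simp_all
  have tf: "transfer_function A B C = matrix_inv (ratfun_mat P) ** ratfun_mat Q"
    "transfer_function A B C = ratfun_mat Q ** matrix_inv (ratfun_mat P')"
    unfolding transfer_function_def P_def P'_def Q_def Bs_def ratfun_mat_mat_poly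
    by (rule ratfun.transfer_function_eq[OF root nz])+
  \<comment> \<open>At a complex point, invertibility of the denominator matrix means that
    \<open>a(z)\<close> is nonzero.\<close>
  have tf_at: "transfer_function_at A B C z = matrix_inv (eval_mat P z) ** eval_mat Q z"
    if "invertible (eval_mat P z)" for z
    using that unfolding transfer_function_at_def P_def Q_def Bs_def eval_mat_mat_poly
    by (intro cplx.transfer_function_eq(1)[OF root]) (simp only: cplx.ev_mat invertible_mat_iff not_False_eq_True)
  have tf_at': "transfer_function_at A B C z = eval_mat Q z ** matrix_inv (eval_mat P' z)"
    if "invertible (eval_mat P' z)" for z
    using that unfolding transfer_function_at_def P'_def Q_def Bs_def eval_mat_mat_poly
    by (intro cplx.transfer_function_eq(2)[OF root]) (simp only: cplx.ev_mat invertible_mat_iff not_False_eq_True)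
  show ?thesis
    by (rule exI[of _ "Suc n"], rule exI[of _ n], rule exI[of _ n], rule exI[of _ P],
        rule exI[of _ Q], rule exI[of _ P'], rule exI[of _ Q], rule exI[of _ "\<lambda>i. mat (a i)"],
        rule exI[of _ Bs], rule exI[of _ "\<lambda>i. mat (a i)"], rule exI[of _ Bs])
      (use a0 inv tf tf_at tf_at' in \<open>auto simp: P_def P'_def Q_def\<close>)
qed

end
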